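(* Let $\mathcal{G}=(\mathcal{V},\mathcal{E})$ be a simple graph with $\mathcal{V}=\{1,\dots,N\}$ and adjacency matrix $(a_{ij})$, let $\kappa>0$, and consider the system $$\dot q_i=p_i+\kappa\sum_{j=1}^N a_{ij}\,G_{01}(q_i-q_j,p_i-p_j),\qquad \dot p_i=-\sin q_i-\kappa\sum_{j=1}^N a_{ij}\,G_{10}(q_i-q_j,p_i-p_j),\qquad i=1,\dots,N.$$ Let $\mu:=1/\kappa$, let $Q_i:=\kappa q_i$, $P_i:=\kappa p_i$, and let $\bar Q:=\frac1N\sum_{i=1}^N Q_i$, $\bar P:=\frac1N\sum_{i=1}^N P_i$ be the rescaled centre of mass coordinates. For $\mu\ll 1$ sufficiently small, the evolution of the centre of mass is equivalent to a perturbed harmonic oscillator with natural frequency $\omega=1$, i.e. $$\dot{\bar Q}=\bar P,\qquad \dot{\bar P}=-\bar Q+O(\mu).$$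
   Context: The interaction $G:\mathbb{R}^2\to\mathbb{R}$ is analytic of the form $G(x,y)=\sum_{l,m=0}^\infty c_{lm}x^{2l}y^{2m}$ with $c_{lm}\in\mathbb{R}$, and $G\ge 0$. Partial derivatives are written $G_{ij}(x,y)=\frac{\partial^{i+j}G}{\partial x^i\partial y^j}(x,y)$. The centre of mass of the original system is $\bar q=\frac1N\sum_i q_i$, $\bar p=\frac1N\sum_i p_i$, so $\bar Q=\kappa\bar q$ and $\bar P=\kappa\bar p$. The symbol $O(\mu)$ is understood as $\mu\to 0$ with the rescaled coordinates $(Q_i)$ in a bounded set. *)

theory Defs
  imports "HOL-Analysis.Analysis" "HOL-Library.Landau_Symbols"
begin

text \<open>Undirected edges are two-element subsets of the vertex set, which excludes loops and
  multiple edges.\<close>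

definition simple_graph :: "'v set \<Rightarrow> 'v set set \<Rightarrow> bool" where
  "simple_graph V E \<longleftrightarrow> finite V \<and> (\<forall>e\<in>E. e \<subseteq> V \<and> card e = 2)"

definition adjacency_matrix :: "'n set set \<Rightarrow> real ^ 'n ^ 'n" where
  "adjacency_matrix E = (\<chi> i j. if {i, j} \<in> E then 1 else 0)"

text \<open>\<open>partial_deriv i j G x y\<close> is the partial derivative of order \<open>i\<close> in the first and
  \<open>j\<close> in the second variable.\<close>

definition partial_deriv :: "nat \<Rightarrow> nat \<Rightarrow> (real \<Rightarrow> real \<Rightarrow> real) \<Rightarrow> real \<Rightarrow> real \<Rightarrow> real" where
  "partial_deriv i j G x y = (deriv ^^ i) (\<lambda>u. (deriv ^^ j) (\<lambda>v. G u v) y) x"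

text \<open>Derivatives are taken within the time domain \<open>T\<close>, so they are one-sided at
  endpoints belonging to \<open>T\<close>.\<close>

definition network_solution ::
  "real \<Rightarrow> (real \<Rightarrow> real \<Rightarrow> real) \<Rightarrow> real ^ 'n ^ 'n \<Rightarrow> real set \<Rightarrow>
   (real \<Rightarrow> real ^ 'n) \<Rightarrow> (real \<Rightarrow> real ^ 'n) \<Rightarrow> bool" where
  "network_solution \<kappa> G a T q p \<longleftrightarrow> (\<forall>t\<in>T. \<forall>i.
     ((\<lambda>s. q s $ i) has_real_derivative
        p t $ i + \<kappa> * (\<Sum>j\<in>UNIV. a $ i $ j *
          partial_deriv 0 1 G (q t $ i - q t $ j) (p t $ i - p t $ j))) (at t within T) \<and>
     ((\<lambda>s. p s $ i) has_real_derivative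
        - sin (q t $ i) - \<kappa> * (\<Sum>j\<in>UNIV. a $ i $ j *
          partial_deriv 1 0 G (q t $ i - q t $ j) (p t $ i - p t $ j))) (at t within T))"

definition centre_of_mass :: "real ^ 'n \<Rightarrow> real" where
  "centre_of_mass x = (\<Sum>i\<in>UNIV. x $ i) / real CARD('n)"

end

theory Submission
  imports Defs
begin

text \<open>
  The coupling terms drop out of the equations for the centre of mass. An interaction that is
  even in each variable has gradient odd under \<open>(x, y) \<mapsto> (-x, -y)\<close>, so the forces which two
  adjacent vertices exert on each other are opposite, and they cancel in the sum over the
  vertices because the adjacency matrix is symmetric (lemma
  \<open>sum_symmetric_antisymmetric_eq_0\<close>). What is left is the average of \<open>N\<close> uncoupled
  pendulums \<open>q' = p\<close>, \<open>p' = - sin q\<close>. After rescaling, the pendulum force on vertex \<open>i\<close> is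
  \<open>- sin (\<mu> Q\<^sub>i) / \<mu> = - Q\<^sub>i + O(\<mu>)\<close>, and averaging gives the oscillator with an explicit
  remainder (\<open>oscillator_remainder\<close>) that depends on \<open>\<mu>\<close> and \<open>Q\<close> alone and not on the solution.

  The expansion of the interaction enters twice: its exponents give the parity, and its
  convergence gives the existence of the partial derivatives. Existence matters because
  \<open>deriv\<close> has an unspecified value where no derivative exists, and that value need not be odd.
\<close>

section \<open>Partial derivatives of an even double power series\<close>

text \<open>Unconditional summability over the index pairs permits summing row by row, which turns the
  double series into an ordinary power series in one of the variables.\<close>

lemma has_sum_rows_sums:
  fixes a :: "nat \<Rightarrow> nat \<Rightarrow> real"
  assumes "((\<lambda>(l, m). a l m) has_sum s) UNIV"
  shows "(\<lambda>l. \<Sum>\<^sub>\<infinity>m. a l m) sums s"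
proof -
  have summable: "(\<lambda>(l, m). a l m) summable_on UNIV \<times> UNIV"
    using assms has_sum_imp_summable by simp blast
  have rows: "(a l has_sum (\<Sum>\<^sub>\<infinity>m. a l m)) UNIV" for l
    using summable_on_SigmaD1[OF summable, of l] by simp
  have "((\<lambda>l. \<Sum>\<^sub>\<infinity>m. a l m) has_sum s) UNIV"
    by (rule has_sum_SigmaD[where A = UNIV and B = "\<lambda>_. UNIV" and f = "\<lambda>(l, m). a l m"])
      (use assms rows in auto)
  then show ?thesis
    by (rule has_sum_imp_sums)
qed

lemma even_powser_differentiable:
  fixes f :: "real \<Rightarrow> real" and d :: "nat \<Rightarrow> real"
  assumes f: "\<And>x. (\<lambda>l. d l * x ^ (2 * l)) sums f x"
  shows "f field_differentiable at x"
proof -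
  \<comment> \<open>Substituting \<open>z = x\<^sup>2\<close> gives a power series known to converge for \<open>z \<ge> 0\<close>; this makes its
    radius of convergence infinite.\<close>
  have "summable (\<lambda>l. d l * z ^ l)" for z
  proof (rule powser_inside)
    show "summable (\<lambda>l. d l * ((\<bar>z\<bar> + 1)\<^sup>2) ^ l)"
      using f[of "\<bar>z\<bar> + 1"] by (simp add: power_mult sums_iff)
    show "norm z < norm ((\<bar>z\<bar> + 1)\<^sup>2)"
      by (simp add: power2_eq_square algebra_simps add_pos_nonneg)
  qed
  then have F: "((\<lambda>z. \<Sum>l. d l * z ^ l) has_field_derivative (\<Sum>l. diffs d l * z ^ l)) (at z)"
    for z by (rule termdiffs_strong_converges_everywhere)
  have "f = (\<lambda>x. \<Sum>l. d l * (x\<^sup>2) ^ l)"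
    using f by (auto simp: sums_iff power_mult)
  moreover have "((\<lambda>x. \<Sum>l. d l * (x\<^sup>2) ^ l) has_field_derivative
      (\<Sum>l. diffs d l * (x\<^sup>2) ^ l) * (2 * x)) (at x)"
    by (rule DERIV_chain2[OF F]) (auto intro!: derivative_eq_intros)
  ultimately show ?thesis
    unfolding field_differentiable_def by blast
qed

lemma deriv_even_function_odd:
  fixes f :: "real \<Rightarrow> real"
  assumes "f field_differentiable at x" and even: "\<And>x. f (- x) = f x"
  shows "deriv f (- x) = - deriv f x"
proof -
  have "DERIV f x :> deriv f x"
    using assms(1) by (simp add: DERIV_deriv_iff_field_differentiable)
  then have "DERIV (\<lambda>u. f (- u)) (- x) :> - deriv f x"
    using DERIV_mirror[where f = f and x = "- x" and y = "deriv f x"] by simp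
  then show ?thesis
    by (simp add: even DERIV_imp_deriv)
qed

text \<open>Each partial function is an even power series in its own variable, with coefficients that
  collect the powers of the other one. Its derivative therefore exists and is odd in that
  variable; in the other variable it is even, so reversing both signs changes the sign once.\<close>

lemma even_double_powser_partials:
  fixes G :: "real \<Rightarrow> real \<Rightarrow> real" and c :: "nat \<Rightarrow> nat \<Rightarrow> real"
  assumes G: "\<And>x y. ((\<lambda>(l, m). c l m * x ^ (2 * l) * y ^ (2 * m)) has_sum G x y) UNIV"
  shows partial_deriv_1_0_odd:
      "partial_deriv 1 0 G (- x) (- y) = - partial_deriv 1 0 G x y"
    and partial_deriv_0_1_odd:
      "partial_deriv 0 1 G (- x) (- y) = - partial_deriv 0 1 G x y"
proof -
  have even: "G (- x) y = G x y" "G x (- y) = G x y" for x y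
    using has_sum_unique[OF G[of "- x" y]] has_sum_unique[OF G[of x "- y"]] G[of x y]
    by (simp_all add: power_mult)
  have rows: "(\<lambda>l. (\<Sum>\<^sub>\<infinity>m. c l m * y ^ (2 * m)) * x ^ (2 * l)) sums G x y" for x y
  proof -
    have "((\<lambda>(l, m). c l m * y ^ (2 * m) * x ^ (2 * l)) has_sum G x y) UNIV"
      using G[of x y] by (simp only: mult.assoc mult.commute[of "x ^ _"])
    from has_sum_rows_sums[OF this] show ?thesis
      by (simp add: infsum_cmult_left')
  qed
  have "((\<lambda>(m, l). c l m * x ^ (2 * l) * y ^ (2 * m)) has_sum G x y) UNIV" for x y
    using has_sum_swap[where A = UNIV and B = UNIV, of
        "\<lambda>(l, m). c l m * x ^ (2 * l) * y ^ (2 * m)" "G x y"] G[of x y]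
    by simp
  from has_sum_rows_sums[OF this]
  have columns: "(\<lambda>m. (\<Sum>\<^sub>\<infinity>l. c l m * x ^ (2 * l)) * y ^ (2 * m)) sums G x y" for x y
    by (simp add: infsum_cmult_left')
  have "G (- x) = G x" "(\<lambda>u. G u (- y)) = (\<lambda>u. G u y)"
    using even by auto
  then show "partial_deriv 1 0 G (- x) (- y) = - partial_deriv 1 0 G x y"
    and "partial_deriv 0 1 G (- x) (- y) = - partial_deriv 0 1 G x y"
    using deriv_even_function_odd[OF even_powser_differentiable[OF rows], of y x] even
      deriv_even_function_odd[OF even_powser_differentiable[OF columns], of x y]
    by (simp_all add: partial_deriv_def)
qed

section \<open>Cancellation of the coupling\<close>

lemma sum_symmetric_antisymmetric_eq_0:
  fixes a h :: "'a \<Rightarrow> 'a \<Rightarrow> real"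
  assumes "\<And>i j. a i j = a j i" and "\<And>i j. h j i = - h i j"
  shows "(\<Sum>i\<in>I. \<Sum>j\<in>I. a i j * h i j) = 0"
proof -
  have "(\<Sum>i\<in>I. \<Sum>j\<in>I. a i j * h i j) = (\<Sum>j\<in>I. \<Sum>i\<in>I. a i j * h i j)"
    by (rule sum.swap)
  also have "\<dots> = (\<Sum>j\<in>I. \<Sum>i\<in>I. - (a j i * h j i))"
    by (intro sum.cong refl) (metis assms mult_minus_right)
  also have "\<dots> = - (\<Sum>i\<in>I. \<Sum>j\<in>I. a i j * h i j)"
    by (simp add: sum_negf)
  finally show ?thesis
    by simp
qed

lemma coupling_sum_eq_0:
  fixes g :: "real \<Rightarrow> real \<Rightarrow> real" and q p :: "real ^ 'n::finite"
  assumes odd: "\<And>x y. g (- x) (- y) = - g x y"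
  shows "(\<Sum>i\<in>UNIV. \<Sum>j\<in>UNIV. adjacency_matrix E $ i $ j * g (q $ i - q $ j) (p $ i - p $ j)) = 0"
proof (rule sum_symmetric_antisymmetric_eq_0)
  show "adjacency_matrix E $ i $ j = (adjacency_matrix E $ j $ i :: real)" for i j :: 'n
    by (simp add: adjacency_matrix_def insert_commute)
  show "g (q $ j - q $ i) (p $ j - p $ i) = - g (q $ i - q $ j) (p $ i - p $ j)" for i j
    using odd[of "q $ i - q $ j" "p $ i - p $ j"] by simp
qed

text \<open>In the original coordinates the centre of mass moves as the average of uncoupled
  pendulums, for every coupling strength.\<close>

lemma centre_of_mass_derivs:
  fixes E :: "'n::finite set set" and q p :: "real \<Rightarrow> real ^ 'n"
  assumes odd: "\<And>x y. partial_deriv 0 1 G (- x) (- y) = - partial_deriv 0 1 G x y"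
      "\<And>x y. partial_deriv 1 0 G (- x) (- y) = - partial_deriv 1 0 G x y"
    and sol: "network_solution \<kappa> G (adjacency_matrix E) T q p" and "t \<in> T"
  shows "((\<lambda>s. centre_of_mass (q s)) has_real_derivative centre_of_mass (p t)) (at t within T)"
    and "((\<lambda>s. centre_of_mass (p s)) has_real_derivative
      - centre_of_mass (\<chi> i. sin (q t $ i))) (at t within T)"
proof -
  let ?S = "\<lambda>g i. \<Sum>j\<in>UNIV. adjacency_matrix E $ i $ j *
    g (q t $ i - q t $ j) (p t $ i - p t $ j)"
  note cancel = coupling_sum_eq_0[where g = "partial_deriv 0 1 G", OF odd(1), of E "q t" "p t"]
    coupling_sum_eq_0[where g = "partial_deriv 1 0 G", OF odd(2), of E "q t" "p t"]
  have "((\<lambda>s. centre_of_mass (q s)) has_real_derivative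
      (\<Sum>i\<in>UNIV. p t $ i + \<kappa> * ?S (partial_deriv 0 1 G) i) / real CARD('n)) (at t within T)"
    unfolding centre_of_mass_def
    using sol \<open>t \<in> T\<close> by (intro DERIV_cdivide DERIV_sum) (auto simp: network_solution_def)
  then show "((\<lambda>s. centre_of_mass (q s)) has_real_derivative centre_of_mass (p t))
      (at t within T)"
    using cancel by (simp add: sum.distrib sum_distrib_left[symmetric] centre_of_mass_def)
  have "((\<lambda>s. centre_of_mass (p s)) has_real_derivative
      (\<Sum>i\<in>UNIV. - sin (q t $ i) - \<kappa> * ?S (partial_deriv 1 0 G) i) / real CARD('n))
      (at t within T)"
    unfolding centre_of_mass_def
    using sol \<open>t \<in> T\<close> by (intro DERIV_cdivide DERIV_sum) (auto simp: network_solution_def)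
  then show "((\<lambda>s. centre_of_mass (p s)) has_real_derivative
      - centre_of_mass (\<chi> i. sin (q t $ i))) (at t within T)"
    using cancel
    by (simp add: sum_subtractf sum_negf sum_distrib_left[symmetric] centre_of_mass_def)
qed

section \<open>The remainder of the harmonic approximation\<close>

definition oscillator_remainder :: "real \<Rightarrow> real ^ 'n \<Rightarrow> real" where
  "oscillator_remainder \<mu> Q = centre_of_mass (\<chi> i. Q $ i - sin (\<mu> * Q $ i) / \<mu>)"

lemma centre_of_mass_scaleR: "centre_of_mass (r *\<^sub>R x) = r * centre_of_mass x"
  by (simp add: centre_of_mass_def sum_distrib_left)

lemma rescaled_pendulum_force:
  fixes q :: "real ^ 'n::finite"
  assumes "\<kappa> > 0"
  shows "\<kappa> * - centre_of_mass (\<chi> i. sin (q $ i)) =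
    - centre_of_mass (\<kappa> *\<^sub>R q) + oscillator_remainder (1 / \<kappa>) (\<kappa> *\<^sub>R q)"
  using assms
  by (simp add: centre_of_mass_def oscillator_remainder_def sum_subtractf sum_distrib_left
      diff_divide_distrib mult.commute)

text \<open>The quadratic Maclaurin bound for the sine suffices for the order claimed.\<close>

lemma abs_sin_diff_le: "\<bar>x - sin x\<bar> \<le> x\<^sup>2 / 2" for x :: real
  using Maclaurin_sin_bound[of x 2]
  by (simp add: numeral_2_eq_2 sin_coeff_def abs_minus_commute power2_eq_square)

lemma abs_oscillator_remainder_le:
  fixes Q :: "real ^ 'n::finite"
  assumes "\<mu> > 0"
  shows "\<bar>oscillator_remainder \<mu> Q\<bar> \<le> (norm Q)\<^sup>2 / 2 * \<mu>"
proof -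
  have component: "\<bar>Q $ i - sin (\<mu> * Q $ i) / \<mu>\<bar> \<le> (norm Q)\<^sup>2 / 2 * \<mu>" for i
  proof -
    have "\<bar>Q $ i - sin (\<mu> * Q $ i) / \<mu>\<bar> = \<bar>\<mu> * Q $ i - sin (\<mu> * Q $ i)\<bar> / \<mu>"
      using assms by (simp add: abs_if field_simps)
    also have "\<dots> \<le> (\<mu> * Q $ i)\<^sup>2 / 2 / \<mu>"
      using assms abs_sin_diff_le by (intro divide_right_mono) auto
    also have "\<dots> = \<bar>Q $ i\<bar>\<^sup>2 / 2 * \<mu>"
      using assms by (simp add: power2_eq_square)
    also have "\<dots> \<le> (norm Q)\<^sup>2 / 2 * \<mu>"
      using assms component_le_norm_cart[of Q i]
      by (intro mult_right_mono divide_right_mono power_mono) auto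
    finally show ?thesis .
  qed
  have "\<bar>\<Sum>i\<in>UNIV. Q $ i - sin (\<mu> * Q $ i) / \<mu>\<bar> \<le> (\<Sum>i::'n\<in>UNIV. (norm Q)\<^sup>2 / 2 * \<mu>)"
    using component by (intro order.trans[OF sum_abs] sum_mono)
  then show ?thesis
    by (simp add: oscillator_remainder_def centre_of_mass_def field_simps)
qed

lemma oscillator_remainder_bigo:
  fixes B :: "(real ^ 'n::finite) set"
  assumes "bounded B"
  shows "(\<lambda>(\<mu>, Q). oscillator_remainder \<mu> Q) \<in> O[at_right 0 \<times>\<^sub>F principal B](\<lambda>(\<mu>, Q). \<mu>)"
proof -
  obtain b where b: "\<And>Q. Q \<in> B \<Longrightarrow> norm Q \<le> b"
    using assms by (auto simp: bounded_iff)
  have "\<bar>oscillator_remainder \<mu> Q\<bar> \<le> b\<^sup>2 / 2 * \<mu>" if "\<mu> > 0" "Q \<in> B" for \<mu> Q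
    using abs_oscillator_remainder_le[OF \<open>\<mu> > 0\<close>, of Q] b[OF \<open>Q \<in> B\<close>] \<open>\<mu> > 0\<close>
    by (meson divide_right_mono less_imp_le mult_right_mono norm_ge_zero order.trans power_mono
        zero_le_numeral)
  moreover have "\<forall>\<^sub>F z in at_right 0 \<times>\<^sub>F principal B. fst z > (0::real) \<and> snd z \<in> B"
    by (rule eventually_mono[OF eventually_prodI[OF eventually_at_right_less[of 0]
          eventually_principal[THEN iffD2]]]) auto
  ultimately show ?thesis
    by (intro bigoI[where c = "b\<^sup>2 / 2"]) (auto elim!: eventually_mono)
qed

section \<open>The rescaled centre of mass\<close>

theorem proposition3:
  fixes E :: "'n::finite set set"
    and G :: "real \<Rightarrow> real \<Rightarrow> real"
    and c :: "nat \<Rightarrow> nat \<Rightarrow> real"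
  assumes "simple_graph (UNIV :: 'n set) E"
    and "\<And>x y. ((\<lambda>(l, m). c l m * x ^ (2 * l) * y ^ (2 * m)) has_sum G x y) UNIV"
    and "\<And>x y. G x y \<ge> 0"
  shows "\<exists>\<rho> :: real \<Rightarrow> real ^ 'n \<Rightarrow> real.
    (\<exists>\<mu>0>0. \<forall>\<kappa>>0. 1 / \<kappa> < \<mu>0 \<longrightarrow>
      (\<forall>T q p. is_interval T \<longrightarrow> network_solution \<kappa> G (adjacency_matrix E) T q p \<longrightarrow>
        (let \<mu> = 1 / \<kappa>; Q = (\<lambda>t. \<kappa> *\<^sub>R q t); P = (\<lambda>t. \<kappa> *\<^sub>R p t) in
          \<forall>t\<in>T.
            ((\<lambda>s. centre_of_mass (Q s)) has_real_derivative
               centre_of_mass (P t)) (at t within T) \<and>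
            ((\<lambda>s. centre_of_mass (P s)) has_real_derivative
               - centre_of_mass (Q t) + \<rho> \<mu> (Q t)) (at t within T)))) \<and>
    (\<forall>B. bounded B \<longrightarrow>
      (\<lambda>(\<mu>, Q). \<rho> \<mu> Q) \<in> O[at_right 0 \<times>\<^sub>F principal B](\<lambda>(\<mu>, Q). \<mu>))"
proof -
  note odd = even_double_powser_partials(2,1)[OF assms(2)]
  have "((\<lambda>s. centre_of_mass (\<kappa> *\<^sub>R q s)) has_real_derivative
        centre_of_mass (\<kappa> *\<^sub>R p t)) (at t within T)"
    and "((\<lambda>s. centre_of_mass (\<kappa> *\<^sub>R p s)) has_real_derivative
        - centre_of_mass (\<kappa> *\<^sub>R q t) + oscillator_remainder (1 / \<kappa>) (\<kappa> *\<^sub>R q t)) (at t within T)"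
    if "\<kappa> > 0" "network_solution \<kappa> G (adjacency_matrix E) T q p" "t \<in> T" for \<kappa> T q p t
    using centre_of_mass_derivs[OF odd that(2,3), THEN DERIV_cmult, of \<kappa>]
    unfolding rescaled_pendulum_force[OF \<open>\<kappa> > 0\<close>] by (simp_all add: centre_of_mass_scaleR)
  \<comment> \<open>The equations hold exactly for every \<open>\<mu> > 0\<close>, so the threshold \<open>1\<close> is arbitrary.\<close>
  then show ?thesis
    by (intro exI[where x = oscillator_remainder] exI[where x = 1] conjI)
      (auto simp: Let_def intro: oscillator_remainder_bigo)
qed

end
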